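(* Let $u=u(x,y)$ be a smooth function on a product of open intervals $I\times J\subset\mathbb{R}^2$, with $u_{xx}\neq0$, $u_{yy}\neq0$ and $u_{xx}u_{yy}-u_{xy}^2\neq0$ everywhere, which is a solution to the system $$\begin{cases}u_{xx}^2u_{yyy}-3u_{xx}u_{yy}u_{xxy}+2u_{xy}u_{yy}u_{xxx}=0,\\ u_{yy}^2u_{xxx}-3u_{xx}u_{yy}u_{xyy}+2u_{xy}u_{xx}u_{yyy}=0.\end{cases}$$ Then $u$ describes a conic in both the planes $(x,u)$ and $(y,u)$: for each fixed $x$ the curve $y\mapsto (y,u(x,y))$ lies on a conic of the $(y,u)$-plane, and for each fixed $y$ the curve $x\mapsto(x,u(x,y))$ lies on a conic of the $(x,u)$-plane.
   Context: A conic in the plane with coordinates $(s,u)$ is the zero set of a polynomial $a s^2+b su+cu^2+ds+eu+f$ with real coefficients not all zero. *)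

theory Defs
  imports "HOL-Analysis.Analysis"
begin

definition pdx :: "(real \<Rightarrow> real \<Rightarrow> real) \<Rightarrow> real \<Rightarrow> real \<Rightarrow> real" where
  "pdx u = (\<lambda>x y. deriv (\<lambda>t. u t y) x)"

definition pdy :: "(real \<Rightarrow> real \<Rightarrow> real) \<Rightarrow> real \<Rightarrow> real \<Rightarrow> real" where
  "pdy u = (\<lambda>x y. deriv (\<lambda>t. u x t) y)"

(* All iterated partial derivatives of order at most k exist and are continuous on S.
   Meant for open S: the derivatives are two-sided. Differentiability is required
   explicitly because deriv is an unspecified value where no derivative exists. *)
primrec Ck_on :: "nat \<Rightarrow> (real \<times> real) set \<Rightarrow> (real \<Rightarrow> real \<Rightarrow> real) \<Rightarrow> bool" where
  "Ck_on 0 S u \<longleftrightarrow> continuous_on S (\<lambda>(x, y). u x y)"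
| "Ck_on (Suc k) S u \<longleftrightarrow>
     continuous_on S (\<lambda>(x, y). u x y) \<and>
     (\<forall>(x, y)\<in>S. (\<lambda>t. u t y) field_differentiable (at x) \<and>
                 (\<lambda>t. u x t) field_differentiable (at y)) \<and>
     Ck_on k S (pdx u) \<and> Ck_on k S (pdy u)"

definition smooth_on :: "(real \<times> real) set \<Rightarrow> (real \<Rightarrow> real \<Rightarrow> real) \<Rightarrow> bool" where
  "smooth_on S u \<longleftrightarrow> (\<forall>k. Ck_on k S u)"

definition is_conic :: "(real \<times> real) set \<Rightarrow> bool" where
  "is_conic C \<longleftrightarrow>
     (\<exists>a b c d e f. (a, b, c, d, e, f) \<noteq> (0, 0, 0, 0, 0, 0) \<and>
        C = {(s, w). a * s\<^sup>2 + b * s * w + c * w\<^sup>2 + d * s + e * w + f = 0})"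

end

theory Submission
  imports Defs
begin

text \<open>Dividing by the Hessian turns the system into \<open>u\<^sub>i\<^sub>j\<^sub>k = l\<^sub>i u\<^sub>j\<^sub>k + l\<^sub>j u\<^sub>i\<^sub>k + l\<^sub>k u\<^sub>i\<^sub>j\<close> for a covector field
  \<open>(l, m)\<close>. Since \<open>u\<^sub>x\<^sub>x u\<^sub>y\<^sub>y - u\<^sub>x\<^sub>y\<^sup>2 \<noteq> 0\<close>, equality of mixed derivatives forces first
  \<open>\<partial>\<^sub>i l\<^sub>j = l\<^sub>i l\<^sub>j + k u\<^sub>i\<^sub>j\<close> for some function \<open>k\<close> and then \<open>\<partial>\<^sub>i k = k l\<^sub>i\<close>. Along a coordinate line this
  closed system of ordinary differential equations integrates to a conic.\<close>

section \<open>Plane curves satisfying Monge's equation\<close>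

lemma zero_derivative_imp_constant:
  fixes f :: "real \<Rightarrow> real"
  assumes "convex I" "\<And>x. x \<in> I \<Longrightarrow> (f has_real_derivative 0) (at x)"
  shows "\<exists>c. \<forall>x\<in>I. f x = c"
  using has_field_derivative_zero_constant[OF assms(1), of f] assms(2)
  by (meson has_field_derivative_at_within)

lemma third_derivative_zero_imp_quadratic:
  fixes f g h :: "real \<Rightarrow> real"
  assumes "convex I"
    and f: "\<And>x. x \<in> I \<Longrightarrow> (f has_real_derivative g x) (at x)"
    and g: "\<And>x. x \<in> I \<Longrightarrow> (g has_real_derivative h x) (at x)"
    and h: "\<And>x. x \<in> I \<Longrightarrow> (h has_real_derivative 0) (at x)"
  obtains p q r where "\<And>x. x \<in> I \<Longrightarrow> f x = p * x\<^sup>2 + q * x + r"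
proof -
  note const = zero_derivative_imp_constant[OF \<open>convex I\<close>]
  obtain p where p: "\<forall>x\<in>I. h x = p"
    using const[of h] h by blast
  have "\<exists>q. \<forall>x\<in>I. g x - p * x = q"
    by (rule const) (auto intro!: derivative_eq_intros g simp: p)
  then obtain q where q: "\<forall>x\<in>I. g x - p * x = q"
    by blast
  have "\<exists>r. \<forall>x\<in>I. f x - p / 2 * x\<^sup>2 - q * x = r"
    using q by (intro const) (auto intro!: derivative_eq_intros f)
  then obtain r where "\<forall>x\<in>I. f x - p / 2 * x\<^sup>2 - q * x = r"
    by blast
  then have "f x = p / 2 * x\<^sup>2 + q * x + r" if "x \<in> I" for x
    using that by force
  then show thesis
    by (rule that)
qed

lemma is_conicI:
  assumes "(a, b, c, d, e, f) \<noteq> (0, 0, 0, 0, 0, 0)"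
    and "\<And>x. x \<in> I \<Longrightarrow> a * x\<^sup>2 + b * x * w x + c * (w x)\<^sup>2 + d * x + e * w x + f = 0"
  shows "\<exists>C. is_conic C \<and> (\<lambda>x. (x, w x)) ` I \<subseteq> C"
  using assms unfolding is_conic_def
  by (intro exI[of _ "{(s, w). a * s\<^sup>2 + b * s * w + c * w\<^sup>2 + d * s + e * w + f = 0}"]) blast

text \<open>With \<open>\<psi> = a\<^sup>-\<^sup>1\<^sup>/\<^sup>3\<close> the hypotheses say that \<open>k = \<kappa> \<psi>\<close> is constant, that
  \<open>\<psi> + k f\<close> is affine and that \<open>\<psi>\<^sup>2\<close> is quadratic in \<open>x\<close>, so that squaring the affine function gives
  the conic. When \<open>k = 0\<close> this equation no longer involves \<open>f\<close>, but then \<open>f \<psi>\<close> is quadratic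
  and \<open>\<psi>\<close> affine.\<close>

lemma conic_of_ode:
  fixes f f' a l \<kappa> :: "real \<Rightarrow> real"
  assumes "convex I"
    and f: "\<And>x. x \<in> I \<Longrightarrow> (f has_real_derivative f' x) (at x)"
    and f': "\<And>x. x \<in> I \<Longrightarrow> (f' has_real_derivative a x) (at x)"
    and a: "\<And>x. x \<in> I \<Longrightarrow> (a has_real_derivative 3 * (l x * a x)) (at x)"
    and l: "\<And>x. x \<in> I \<Longrightarrow> (l has_real_derivative l x * l x + \<kappa> x * a x) (at x)"
    and \<kappa>: "\<And>x. x \<in> I \<Longrightarrow> (\<kappa> has_real_derivative \<kappa> x * l x) (at x)"
    and nz: "\<And>x. x \<in> I \<Longrightarrow> a x \<noteq> 0"
  shows "\<exists>C. is_conic C \<and> (\<lambda>x. (x, f x)) ` I \<subseteq> C"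
proof -
  note const = zero_derivative_imp_constant[OF \<open>convex I\<close>]
  \<comment> \<open>\<open>a\<close> may be negative; the odd root \<open>root 3\<close> is real for
    either sign and differentiable away from 0.\<close>
  define \<psi> where "\<psi> x = inverse (root 3 (a x))" for x
  have \<psi>_nz: "\<psi> x \<noteq> 0" if "x \<in> I" for x
    using nz[OF that] by (simp add: \<psi>_def)
  \<comment> \<open>The factor 3 in \<open>a' = 3 l a\<close> cancels against the exponent: the cube
    root has logarithmic derivative \<open>l\<close>, its inverse \<open>- l\<close>.\<close>
  have \<psi>: "(\<psi> has_real_derivative - (l x * \<psi> x)) (at x)" if x: "x \<in> I" for x
  proof -
    define r where "r = root 3 (a x)"
    have r: "r \<noteq> 0" "a x = r ^ 3"
      using nz[OF x] by (simp_all add: r_def odd_real_root_pow)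
    have "(root 3 has_real_derivative inverse (3 * r ^ 2)) (at (a x))"
      using DERIV_odd_real_root[of 3 "a x"] nz[OF x]
      by (simp add: r_def power2_eq_square odd_numeral)
    from DERIV_chain2[OF this a[OF x]]
    have "((\<lambda>t. root 3 (a t)) has_real_derivative inverse (3 * r ^ 2) * (3 * (l x * a x))) (at x)" .
    moreover have "inverse (3 * r ^ 2) * (3 * (l x * a x)) = l x * r"
      using r by (simp add: field_simps power2_eq_square power3_eq_cube)
    ultimately have "((\<lambda>t. root 3 (a t)) has_real_derivative l x * r) (at x)"
      by (simp only:)
    from DERIV_inverse'[OF this] nz[OF x]
    have "(\<psi> has_real_derivative - (inverse r * (l x * r) * inverse r)) (at x)"
      by (simp add: \<psi>_def[abs_def] r_def)
    moreover have "inverse r * (l x * r) * inverse r = l x * \<psi> x"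
      using r(1) by (simp add: \<psi>_def r_def[symmetric])
    ultimately show ?thesis
      by (simp only:)
  qed
  have "\<exists>k. \<forall>x\<in>I. \<kappa> x * \<psi> x = k"
    by (rule const) (auto intro!: derivative_eq_intros \<kappa> \<psi>)
  then obtain k where k: "\<And>x. x \<in> I \<Longrightarrow> \<kappa> x * \<psi> x = k"
    by blast
  \<comment> \<open>The terms in \<open>l\<^sup>2\<close> cancel and leave
    \<open>\<kappa> a \<psi> = k a\<close>, which is also the derivative of
    \<open>k f'\<close>.\<close>
  have l\<psi>: "((\<lambda>x. l x * \<psi> x) has_real_derivative k * a x) (at x)" if "x \<in> I" for x
    unfolding k[OF that, symmetric] using that
    by (auto intro!: derivative_eq_intros l \<psi>) (simp add: algebra_simps power2_eq_square)
  have "\<exists>p. \<forall>x\<in>I. k * f' x - l x * \<psi> x = p"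
    by (rule const) (use DERIV_diff[OF DERIV_cmult[OF f', of _ k] l\<psi>] in simp)
  then obtain p where p: "\<And>x. x \<in> I \<Longrightarrow> k * f' x - l x * \<psi> x = p"
    by blast
  \<comment> \<open>The derivative is \<open>- l \<psi> + k f' - p\<close>, which vanishes by the
    choice of \<open>p\<close>.\<close>
  have "\<exists>q. \<forall>x\<in>I. \<psi> x + k * f x - p * x = q"
    using p by (intro const) (auto intro!: derivative_eq_intros f \<psi> simp: mult.commute)
  then obtain q where "\<And>x. x \<in> I \<Longrightarrow> \<psi> x + k * f x - p * x = q"
    by blast
  then have affine: "\<psi> x = p * x + q - k * f x" if "x \<in> I" for x
    using that by force
  show ?thesis
  proof (cases "k = 0")
    case False
    \<comment> \<open>The two functions supplied are the first and second derivatives of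
      \<open>\<psi>\<^sup>2\<close>; in the third, the terms \<open>l\<^sup>3\<close> and
      \<open>\<kappa> l a\<close> each cancel.\<close>
    obtain p' q' r' where quad: "\<And>x. x \<in> I \<Longrightarrow> (\<psi> x)\<^sup>2 = p' * x\<^sup>2 + q' * x + r'"
    proof (rule third_derivative_zero_imp_quadratic[OF \<open>convex I\<close>, of "\<lambda>x. (\<psi> x)\<^sup>2"
          "\<lambda>x. - 2 * l x * (\<psi> x)\<^sup>2" "\<lambda>x. (2 * (l x)\<^sup>2 - 2 * \<kappa> x * a x) * (\<psi> x)\<^sup>2"])
    qed (auto intro!: derivative_eq_intros \<psi> l a \<kappa>, (simp add: algebra_simps power2_eq_square)+)
    show ?thesis
    proof (rule is_conicI)
      \<comment> \<open>The coefficients are those of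
        \<open>(p x + q - k f)\<^sup>2 - (p' x\<^sup>2 + q' x + r')\<close>; the entry
        \<open>k\<^sup>2\<close> is nonzero.\<close>
      show "(p\<^sup>2 - p', - 2 * k * p, k\<^sup>2, 2 * p * q - q', - 2 * k * q, q\<^sup>2 - r') \<noteq> (0, 0, 0, 0, 0, 0)"
        using False by simp
      show "(p\<^sup>2 - p') * x\<^sup>2 + (- 2 * k * p) * x * f x + k\<^sup>2 * (f x)\<^sup>2 + (2 * p * q - q') * x
          + (- 2 * k * q) * f x + (q\<^sup>2 - r') = 0" if "x \<in> I" for x
        using quad[OF that] unfolding affine[OF that]
        by (simp add: algebra_simps power2_eq_square)
    qed
  next
    case True
    have \<kappa>0: "\<kappa> x = 0" if "x \<in> I" for x
      using k[OF that] \<psi>_nz[OF that] True by simp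
    \<comment> \<open>With \<open>\<kappa> = 0\<close> the product \<open>l \<psi>\<close> is
      constant, so the third derivative of \<open>f \<psi>\<close> is
      \<open>(3 - 1 - 2) l a \<psi> = 0\<close>.\<close>
    obtain p' q' r' where quad: "\<And>x. x \<in> I \<Longrightarrow> f x * \<psi> x = p' * x\<^sup>2 + q' * x + r'"
    proof (rule third_derivative_zero_imp_quadratic[OF \<open>convex I\<close>, of "\<lambda>x. f x * \<psi> x"
          "\<lambda>x. f' x * \<psi> x - f x * (l x * \<psi> x)" "\<lambda>x. a x * \<psi> x - 2 * f' x * (l x * \<psi> x)"])
    qed (auto intro!: derivative_eq_intros f f' \<psi> l a simp: \<kappa>0 algebra_simps power2_eq_square)
    show ?thesis
    proof (cases "I = {}")
      case False
      then obtain x0 where "x0 \<in> I"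
        by blast
      \<comment> \<open>This is \<open>\<psi> x0\<close>, so \<open>p\<close> and \<open>q\<close>
        are not both zero; they become the coefficients of \<open>x f\<close> and \<open>f\<close>
        in the conic.\<close>
      then have "p * x0 + q \<noteq> 0"
        using affine \<psi>_nz True by force
      show ?thesis
      proof (rule is_conicI)
        show "(- p', p, 0, - q', q, - r') \<noteq> (0, 0, 0, 0, 0, 0)"
          using \<open>p * x0 + q \<noteq> 0\<close> by auto
        show "- p' * x\<^sup>2 + p * x * f x + 0 * (f x)\<^sup>2 + (- q') * x + q * f x + - r' = 0"
          if "x \<in> I" for x
          using quad[OF that] unfolding affine[OF that] True
          by (simp add: algebra_simps)
      qed
    next
      \<comment> \<open>Over an empty interval any conic will do.\<close>
      case True
      show ?thesis
        by (rule is_conicI[where a = 1 and b = 0 and c = 0 and d = 0 and e = 0 and f = 0])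
          (simp_all add: True)
    qed
  qed
qed


section \<open>Partial derivatives\<close>

lemma Ck_on_pd:
  assumes "Ck_on (Suc k) S f"
  shows "Ck_on k S (pdx f)" "Ck_on k S (pdy f)"
  using assms by simp_all

lemma Ck_on_continuous: "Ck_on k S f \<Longrightarrow> continuous_on S (\<lambda>(x, y). f x y)"
  by (cases k) simp_all

lemma Ck_on_DERIV:
  assumes "Ck_on (Suc k) S f" "(x, y) \<in> S"
  shows "((\<lambda>t. f t y) has_real_derivative pdx f x y) (at x)"
    and "((\<lambda>t. f x t) has_real_derivative pdy f x y) (at y)"
  using assms by (auto simp: pdx_def pdy_def field_differentiable_derivI)

lemma Ck_on_Suc_imp: "Ck_on (Suc k) S f \<Longrightarrow> Ck_on k S f"
proof (induction k arbitrary: f)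
  case (Suc k)
  show ?case
    using Suc.prems Suc.IH[OF Ck_on_pd(1)[OF Suc.prems]] Suc.IH[OF Ck_on_pd(2)[OF Suc.prems]]
    unfolding Ck_on.simps(2)[of k] Ck_on.simps(2)[of "Suc k"] by blast
qed simp

section \<open>Locality of partial derivatives on open sets\<close>

lemma open_slices:
  assumes "open S" "(x, y) \<in> S"
  shows "\<forall>\<^sub>F t in nhds x. (t, y) \<in> S" "\<forall>\<^sub>F t in nhds y. (x, t) \<in> S"
proof -
  have "\<forall>\<^sub>F p in nhds x \<times>\<^sub>F nhds y. p \<in> S"
    using assms by (simp add: nhds_prod[symmetric] eventually_nhds_in_open)
  then obtain P Q where "eventually P (nhds x)" "eventually Q (nhds y)"
      and "\<And>s t. P s \<Longrightarrow> Q t \<Longrightarrow> (s, t) \<in> S"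
    unfolding eventually_prod_filter by blast
  then show "\<forall>\<^sub>F t in nhds x. (t, y) \<in> S" "\<forall>\<^sub>F t in nhds y. (x, t) \<in> S"
    by (auto elim!: eventually_mono dest: eventually_nhds_x_imp_x)
qed

text \<open>Allows an identity valid only on \<open>S\<close> to be differentiated:
  \<open>deriv\<close> sees only values near the point, and these stay in \<open>S\<close>.\<close>

lemma pd_eqI:
  assumes "open S" "(x, y) \<in> S" and eq: "\<And>s t. (s, t) \<in> S \<Longrightarrow> f s t = g s t"
  shows "((\<lambda>t. g t y) has_real_derivative D) (at x) \<Longrightarrow> pdx f x y = D"
    and "((\<lambda>t. g x t) has_real_derivative D) (at y) \<Longrightarrow> pdy f x y = D"
proof -
  have "\<forall>\<^sub>F t in nhds x. f t y = g t y" "\<forall>\<^sub>F t in nhds y. f x t = g x t"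
    using open_slices[OF assms(1,2)] by (auto elim!: eventually_mono simp: eq)
  then show "((\<lambda>t. g t y) has_real_derivative D) (at x) \<Longrightarrow> pdx f x y = D"
    and "((\<lambda>t. g x t) has_real_derivative D) (at y) \<Longrightarrow> pdy f x y = D"
    by (simp_all add: pdx_def pdy_def deriv_cong_ev DERIV_imp_deriv)
qed

lemma pd_cong:
  assumes "open S" "(x, y) \<in> S" and eq: "\<And>s t. (s, t) \<in> S \<Longrightarrow> f s t = g s t"
  shows "pdx f x y = pdx g x y" "pdy f x y = pdy g x y"
proof -
  have "\<forall>\<^sub>F t in nhds x. f t y = g t y" "\<forall>\<^sub>F t in nhds y. f x t = g x t"
    using open_slices[OF assms(1,2)] by (auto elim!: eventually_mono simp: eq)
  then show "pdx f x y = pdx g x y" "pdy f x y = pdy g x y"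
    by (simp_all add: pdx_def pdy_def deriv_cong_ev)
qed

text \<open>Agreement on an open set passes to both partial derivatives, so the induction carries
  \<open>f\<close> and \<open>g\<close> along together.\<close>

lemma Ck_on_cong:
  assumes "open S" and eq: "\<And>x y. (x, y) \<in> S \<Longrightarrow> f x y = g x y" and "Ck_on k S g"
  shows "Ck_on k S f"
  using eq assms(3)
proof (induction k arbitrary: f g)
  case 0
  have "continuous_on S (\<lambda>(x, y). g x y)"
    using 0(2) by simp
  then show ?case
    using 0(1) by (auto intro: continuous_on_eq)
next
  case (Suc k)
  have cont: "continuous_on S (\<lambda>(x, y). f x y)"
    using Ck_on_continuous[OF Suc.prems(2)] Suc.prems(1) by (auto intro: continuous_on_eq)
  have "(\<lambda>t. f t y) field_differentiable at x" "(\<lambda>t. f x t) field_differentiable at y"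
    if "(x, y) \<in> S" for x y
  proof -
    have ev: "\<forall>\<^sub>F t in nhds x. g t y = f t y" "\<forall>\<^sub>F t in nhds y. g x t = f x t"
      using open_slices[OF assms(1) that] by (auto elim!: eventually_mono simp: Suc.prems(1))
    show "(\<lambda>t. f t y) field_differentiable at x" "(\<lambda>t. f x t) field_differentiable at y"
      using Ck_on_DERIV[OF Suc.prems(2) that] DERIV_cong_ev[OF refl ev(1) refl]
        DERIV_cong_ev[OF refl ev(2) refl]
      unfolding field_differentiable_def by blast+
  qed
  moreover have "pdx f x y = pdx g x y" "pdy f x y = pdy g x y" if "(x, y) \<in> S" for x y
    using pd_cong[OF assms(1) that, of f g] Suc.prems(1) by blast+
  then have "Ck_on k S (pdx f)" "Ck_on k S (pdy f)"
    using Suc.IH Ck_on_pd[OF Suc.prems(2)] by blast+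
  ultimately show ?case
    using cont by auto
qed

text \<open>Closed forms known only on \<open>S\<close> may stand in for \<open>pdx f\<close> and
  \<open>pdy f\<close>; the induction steps for the algebraic operations rest on this.\<close>

lemma Ck_on_SucI:
  assumes "open S"
    and "\<And>x y. (x, y) \<in> S \<Longrightarrow> ((\<lambda>t. f t y) has_real_derivative fx x y) (at x)"
    and "\<And>x y. (x, y) \<in> S \<Longrightarrow> ((\<lambda>t. f x t) has_real_derivative fy x y) (at y)"
    and "Ck_on k S fx" "Ck_on k S fy"
    and "continuous_on S (\<lambda>(x, y). f x y)"
  shows "Ck_on (Suc k) S f"
proof -
  have "pdx f x y = fx x y" "pdy f x y = fy x y" if "(x, y) \<in> S" for x y
    using assms(2,3)[OF that] by (simp_all add: pdx_def pdy_def DERIV_imp_deriv)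
  then have "Ck_on k S (pdx f)" "Ck_on k S (pdy f)"
    using Ck_on_cong[OF assms(1)] assms(4,5) by blast+
  moreover have "(\<lambda>t. f t y) field_differentiable at x" "(\<lambda>t. f x t) field_differentiable at y"
    if "(x, y) \<in> S" for x y
    using assms(2,3)[OF that] unfolding field_differentiable_def by blast+
  ultimately show ?thesis
    using assms(6) by auto
qed

section \<open>Closure of \<open>Ck_on\<close> under constants, sums, products and inverses\<close>

lemma Ck_on_const: "open S \<Longrightarrow> Ck_on k S (\<lambda>x y. c)"
proof (induction k arbitrary: c)
  case (Suc k)
  show ?case
    by (rule Ck_on_SucI[where fx = "\<lambda>x y. 0" and fy = "\<lambda>x y. 0"])
      (use Suc in auto)
qed simp

lemma Ck_on_add:
  assumes "open S" "Ck_on k S f" "Ck_on k S g"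
  shows "Ck_on k S (\<lambda>x y. f x y + g x y)"
  using assms(2,3)
proof (induction k arbitrary: f g)
  case 0
  then show ?case
    by (auto simp: case_prod_unfold intro!: continuous_intros)
next
  case (Suc k)
  show ?case
    using Suc.prems[THEN Ck_on_continuous]
    by (intro Ck_on_SucI[where fx = "\<lambda>x y. pdx f x y + pdx g x y"
          and fy = "\<lambda>x y. pdy f x y + pdy g x y"] Suc.IH assms(1) DERIV_add
          Ck_on_pd[OF Suc.prems(1)] Ck_on_pd[OF Suc.prems(2)]
          Ck_on_DERIV[OF Suc.prems(1)] Ck_on_DERIV[OF Suc.prems(2)])
      (auto simp: case_prod_unfold intro!: continuous_intros)
qed

text \<open>The product rule leaves undifferentiated factors, whose order has to be lowered from
  \<open>Suc k\<close> to \<open>k\<close> before the induction hypothesis applies.\<close>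

lemma Ck_on_mult:
  assumes "open S" "Ck_on k S f" "Ck_on k S g"
  shows "Ck_on k S (\<lambda>x y. f x y * g x y)"
  using assms(2,3)
proof (induction k arbitrary: f g)
  case 0
  then show ?case
    by (auto simp: case_prod_unfold intro!: continuous_intros)
next
  case (Suc k)
  show ?case
    using Suc.prems[THEN Ck_on_continuous]
    by (intro Ck_on_SucI[where fx = "\<lambda>x y. pdx f x y * g x y + pdx g x y * f x y"
          and fy = "\<lambda>x y. pdy f x y * g x y + pdy g x y * f x y"] Suc.IH assms(1)
          DERIV_mult Ck_on_add Suc.prems[THEN Ck_on_Suc_imp]
          Ck_on_pd[OF Suc.prems(1)] Ck_on_pd[OF Suc.prems(2)]
          Ck_on_DERIV[OF Suc.prems(1)] Ck_on_DERIV[OF Suc.prems(2)])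
      (auto simp: case_prod_unfold intro!: continuous_intros)
qed

text \<open>The partial derivatives contain the inverse itself, for which the induction hypothesis
  gives order \<open>k\<close>. Their sign is written as a constant factor so that closure under
  constants and products suffices.\<close>

lemma Ck_on_inverse:
  assumes "open S" "Ck_on k S f" and nz: "\<And>x y. (x, y) \<in> S \<Longrightarrow> f x y \<noteq> 0"
  shows "Ck_on k S (\<lambda>x y. inverse (f x y))"
  using assms(2)
proof (induction k)
  case 0
  then show ?case
    by (auto simp: case_prod_unfold nz intro!: continuous_intros)
next
  case (Suc k)
  note inv = Suc.IH[OF Ck_on_Suc_imp[OF Suc.prems]]
  note deriv = Ck_on_DERIV[OF Suc.prems]
  show ?case
  proof (rule Ck_on_SucI[where fx = "\<lambda>x y. (- 1) * (inverse (f x y) * pdx f x y * inverse (f x y))"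
        and fy = "\<lambda>x y. (- 1) * (inverse (f x y) * pdy f x y * inverse (f x y))"])
    show "((\<lambda>t. inverse (f t y)) has_real_derivative
        (- 1) * (inverse (f x y) * pdx f x y * inverse (f x y))) (at x)" if "(x, y) \<in> S" for x y
      using DERIV_inverse'[OF deriv(1)[OF that] nz[OF that]] by simp
    show "((\<lambda>t. inverse (f x t)) has_real_derivative
        (- 1) * (inverse (f x y) * pdy f x y * inverse (f x y))) (at y)" if "(x, y) \<in> S" for x y
      using DERIV_inverse'[OF deriv(2)[OF that] nz[OF that]] by simp
    show "continuous_on S (\<lambda>(x, y). inverse (f x y))"
      using Ck_on_continuous[OF Suc.prems]
      by (auto simp: case_prod_unfold nz intro!: continuous_intros)
  qed (intro Ck_on_mult Ck_on_const assms(1) inv Ck_on_pd[OF Suc.prems])+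
qed

section \<open>Transfer of these rules to smooth functions\<close>

lemma smooth_on_pd:
  assumes "smooth_on S f"
  shows "smooth_on S (pdx f)" "smooth_on S (pdy f)"
  using assms Ck_on_pd unfolding smooth_on_def by blast+

lemma smooth_on_DERIV:
  assumes "smooth_on S f" "(x, y) \<in> S"
  shows "((\<lambda>t. f t y) has_real_derivative pdx f x y) (at x)"
    and "((\<lambda>t. f x t) has_real_derivative pdy f x y) (at y)"
  using assms Ck_on_DERIV[of 0] unfolding smooth_on_def by blast+

lemma smooth_on_const: "open S \<Longrightarrow> smooth_on S (\<lambda>x y. c)"
  by (simp add: smooth_on_def Ck_on_const)

lemma smooth_on_mult:
  "open S \<Longrightarrow> smooth_on S f \<Longrightarrow> smooth_on S g \<Longrightarrow> smooth_on S (\<lambda>x y. f x y * g x y)"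
  by (simp add: smooth_on_def Ck_on_mult)

lemma smooth_on_diff:
  assumes "open S" "smooth_on S f" "smooth_on S g"
  shows "smooth_on S (\<lambda>x y. f x y - g x y)"
proof -
  have "smooth_on S (\<lambda>x y. f x y + (- 1) * g x y)"
    using assms unfolding smooth_on_def by (intro allI Ck_on_add Ck_on_mult Ck_on_const) auto
  then show ?thesis
    by simp
qed

lemma smooth_on_divide:
  assumes "open S" "smooth_on S f" "smooth_on S g" "\<And>x y. (x, y) \<in> S \<Longrightarrow> g x y \<noteq> 0"
  shows "smooth_on S (\<lambda>x y. f x y / g x y)"
  using assms unfolding smooth_on_def divide_inverse
  by (intro allI Ck_on_mult Ck_on_inverse) auto

section \<open>Symmetry of the mixed second derivatives\<close>

lemma mixed_difference_eq_pd:
  assumes "Ck_on 2 S f" "h > 0" and sub: "{x..x + h} \<times> {y..y + h} \<subseteq> S"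
  obtains s t where "s \<in> {x..x + h}" "t \<in> {y..y + h}"
    "(f (x + h) (y + h) - f x (y + h)) - (f (x + h) y - f x y) = h\<^sup>2 * pdy (pdx f) s t"
proof -
  have f1: "Ck_on (Suc 0) S (pdx f)" and f2: "Ck_on (Suc (Suc 0)) S f"
    using assms(1) by (simp_all add: numeral_2_eq_2)
  \<comment> \<open>The mean value theorem is applied first in the first variable to the difference
    of two horizontal slices, then in the second variable to \<open>pdx f s\<close>.\<close>
  have "\<exists>s. x < s \<and> s < x + h \<and> (\<lambda>s. f s (y + h) - f s y) (x + h) - (\<lambda>s. f s (y + h) - f s y) x
      = (x + h - x) * (pdx f s (y + h) - pdx f s y)"
    using assms(2) by (intro MVT2 DERIV_diff Ck_on_DERIV[OF f2] sub[THEN subsetD]) auto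
  then obtain s where s: "x < s" "s < x + h"
    "f (x + h) (y + h) - f (x + h) y - (f x (y + h) - f x y) = h * (pdx f s (y + h) - pdx f s y)"
    by auto
  have "\<exists>t. y < t \<and> t < y + h \<and> pdx f s (y + h) - pdx f s y = (y + h - y) * pdy (pdx f) s t"
    using assms(2) s by (intro MVT2 Ck_on_DERIV[OF f1] sub[THEN subsetD]) auto
  then obtain t where "y < t" "t < y + h" "pdx f s (y + h) - pdx f s y = h * pdy (pdx f) s t"
    by auto
  with s show thesis
    by (intro that[of s t]) (auto simp: power2_eq_square)
qed

text \<open>Exchanging the coordinates exchanges \<open>pdx\<close> and \<open>pdy\<close>, so the
  mean value formula for the second difference also becomes available for the other order of
  differentiation.\<close>

lemma Ck_on_swap:
  "Ck_on k S f \<Longrightarrow> Ck_on k (prod.swap ` S) (\<lambda>x y. f y x)"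
proof (induction k arbitrary: f)
  case 0
  have "continuous_on (prod.swap ` S) ((\<lambda>(x, y). f x y) \<circ> prod.swap)"
    using 0 by (intro continuous_on_compose continuous_on_swap) (simp add: image_image)
  then show ?case
    by (simp add: o_def case_prod_unfold)
next
  case (Suc k)
  have "continuous_on (prod.swap ` S) ((\<lambda>(x, y). f x y) \<circ> prod.swap)"
    using Suc.prems by (intro continuous_on_compose continuous_on_swap) (simp add: image_image)
  moreover have "pdx (\<lambda>x y. f y x) = (\<lambda>x y. pdy f y x)" "pdy (\<lambda>x y. f y x) = (\<lambda>x y. pdx f y x)"
    by (simp_all add: pdx_def pdy_def)
  ultimately show ?case
    using Suc by (auto simp: o_def case_prod_unfold)
qed

lemma pdx_pdy_commute:
  assumes "open S" "Ck_on 2 S f" "(x, y) \<in> S"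
  shows "pdx (pdy f) x y = pdy (pdx f) x y"
proof (rule ccontr)
  let ?A = "\<lambda>(s, t). pdx (pdy f) s t" and ?B = "\<lambda>(s, t). pdy (pdx f) s t"
  assume neq: "\<not> ?thesis"
  \<comment> \<open>Half the distance: values within \<open>e\<close> of the two supposedly
    different derivatives cannot coincide.\<close>
  define e where "e = dist (?A (x, y)) (?B (x, y)) / 2"
  have "e > 0"
    using neq by (simp add: e_def)
  have "continuous_on S ?A" "continuous_on S ?B"
    using assms(2) by (auto simp: numeral_2_eq_2)
  then have "isCont ?A (x, y)" "isCont ?B (x, y)"
    using assms(1,3) continuous_on_eq_continuous_at by blast+
  then have "\<forall>\<^sub>F p in nhds (x, y). dist (?A p) (?A (x, y)) < e"
    "\<forall>\<^sub>F p in nhds (x, y). dist (?B p) (?B (x, y)) < e"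
    using \<open>e > 0\<close> by (auto simp: continuous_at tendsto_iff eventually_at_filter elim!: eventually_mono)
  moreover have "\<forall>\<^sub>F p in nhds (x, y). p \<in> S"
    using assms(1,3) by (simp add: eventually_nhds_in_open)
  ultimately have "\<forall>\<^sub>F p in nhds (x, y). p \<in> S \<and> dist (?A p) (?A (x, y)) < e \<and> dist (?B p) (?B (x, y)) < e"
    by eventually_elim simp
  then obtain d where "d > 0" and d: "\<And>p. dist p (x, y) < d \<Longrightarrow>
      p \<in> S \<and> dist (?A p) (?A (x, y)) < e \<and> dist (?B p) (?B (x, y)) < e"
    unfolding eventually_nhds_metric by blast
  \<comment> \<open>A point of the square of side \<open>h\<close> is at distance at most
    \<open>2 * h < d\<close> from its corner.\<close>
  define h where "h = d / 3"
  have "h > 0"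
    using \<open>d > 0\<close> by (simp add: h_def)
  have near: "dist (s, t) (x, y) < d" if "s \<in> {x..x + h}" "t \<in> {y..y + h}" for s t
  proof -
    have "dist (s, t) (x, y) \<le> dist s x + dist t y"
      by (simp add: dist_Pair_Pair sqrt_sum_squares_le_sum)
    also have "\<dots> < d"
      using that \<open>d > 0\<close> by (auto simp: dist_real_def h_def)
    finally show ?thesis .
  qed
  have sub: "{x..x + h} \<times> {y..y + h} \<subseteq> S"
    using near d by blast
  then have sub': "{y..y + h} \<times> {x..x + h} \<subseteq> prod.swap ` S"
    by force
  obtain s t where st: "s \<in> {x..x + h}" "t \<in> {y..y + h}"
    "(f (x + h) (y + h) - f x (y + h)) - (f (x + h) y - f x y) = h\<^sup>2 * pdy (pdx f) s t"
    using mixed_difference_eq_pd[OF assms(2) \<open>h > 0\<close> sub] .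
  \<comment> \<open>The same second difference, now evaluated for the swapped function, produces
    \<open>pdx (pdy f)\<close> at another point of the square.\<close>
  obtain t' s' where st': "t' \<in> {y..y + h}" "s' \<in> {x..x + h}"
    "(f (x + h) (y + h) - f (x + h) y) - (f x (y + h) - f x y)
      = h\<^sup>2 * pdy (pdx (\<lambda>y x. f x y)) t' s'"
    using mixed_difference_eq_pd[OF Ck_on_swap[OF assms(2)] \<open>h > 0\<close> sub'] .
  have swap: "pdy (pdx (\<lambda>y x. f x y)) t' s' = pdx (pdy f) s' t'"
    by (simp add: pdx_def pdy_def)
  have "h\<^sup>2 * pdx (pdy f) s' t' = (f (x + h) (y + h) - f (x + h) y) - (f x (y + h) - f x y)"
    using st'(3) by (simp only: swap)
  also have "\<dots> = (f (x + h) (y + h) - f x (y + h)) - (f (x + h) y - f x y)"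
    by simp
  also have "\<dots> = h\<^sup>2 * pdy (pdx f) s t"
    by (fact st(3))
  finally have "?A (s', t') = ?B (s, t)"
    using \<open>h > 0\<close> by simp
  moreover have "dist (?A (s', t')) (?A (x, y)) < e" "dist (?B (s, t)) (?B (x, y)) < e"
    using d near st st' by blast+
  ultimately have "dist (?A (x, y)) (?B (x, y)) < dist (?A (x, y)) (?B (x, y))"
    unfolding e_def by (metis dist_triangle_half_r)
  then show False
    by simp
qed

lemma smooth_on_pdx_pdy_commute:
  "open S \<Longrightarrow> smooth_on S f \<Longrightarrow> (x, y) \<in> S \<Longrightarrow> pdx (pdy f) x y = pdy (pdx f) x y"
  by (simp add: pdx_pdy_commute smooth_on_def)

section \<open>The system\<close>

text \<open>After substituting \<open>ax\<close> and \<open>cy\<close>, each equation of the system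
  has the factor \<open>3 * a * c\<close>; dividing by it solves for one mixed third derivative. In
  the application \<open>a\<close>, \<open>b\<close>, \<open>c\<close> are the second derivatives of
  \<open>u\<close>.\<close>

lemma third_derivatives_of_system:
  fixes a b c :: real
  assumes "a \<noteq> 0" "c \<noteq> 0" "ax = 3 * (l * a)" "cy = 3 * (m * c)"
    and "a\<^sup>2 * cy - 3 * a * c * ay + 2 * b * c * ax = 0"
    and "c\<^sup>2 * ax - 3 * a * c * by' + 2 * b * a * cy = 0"
  shows "ay = 2 * (b * l) + a * m" "by' = c * l + 2 * (b * m)"
proof -
  have "3 * a * c * (a * m + 2 * b * l - ay) = 0" "3 * a * c * (c * l + 2 * b * m - by') = 0"
    using assms(5,6) unfolding assms(3,4) by (simp_all add: algebra_simps power2_eq_square)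
  then show "ay = 2 * (b * l) + a * m" "by' = c * l + 2 * (b * m)"
    using assms(1,2) by auto
qed

text \<open>Cramer's rule for a homogeneous system with determinant \<open>a * c - b\<^sup>2\<close>
  up to sign; this is how the Hessian condition enters both compatibility arguments.\<close>

lemma linear_system_nondegenerate:
  fixes a b c :: real
  assumes "a * c - b\<^sup>2 \<noteq> 0" "a * s = b * r" "c * r = b * s"
  shows "r = 0" "s = 0"
proof -
  have "(a * c - b\<^sup>2) * r = a * (c * r - b * s) + b * (a * s - b * r)"
    "(a * c - b\<^sup>2) * s = c * (a * s - b * r) + b * (c * r - b * s)"
    by (simp_all add: algebra_simps power2_eq_square)
  then show "r = 0" "s = 0"
    using assms by auto
qed

text \<open>The equations \<open>A\<close>, \<open>B\<close>, \<open>C\<close> say that the mixed derivatives of \<open>a\<close>, \<open>b\<close>, \<open>c\<close> agree, in the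
  form in which the product rule delivers them.\<close>

lemma first_compatibility:
  fixes a b c :: real
  assumes "a \<noteq> 0" "c \<noteq> 0" "a * c - b\<^sup>2 \<noteq> 0"
    and third: "ax = 3 * (l * a)" "ay = 2 * (b * l) + a * m" "bx = 2 * (b * l) + a * m"
      "by' = c * l + 2 * (b * m)" "cx = c * l + 2 * (b * m)" "cy = 3 * (m * c)"
    and k: "lx = l * l + k * a"
    and A: "2 * (bx * l + lx * b) + (ax * m + mx * a) = 3 * (ly * a + ay * l)"
    and B: "(cx * l + lx * c) + 2 * (bx * m + mx * b) = 2 * (by' * l + ly * b) + (ay * m + my * a)"
    and C: "3 * (mx * c + cx * m) = (cy * l + ly * c) + 2 * (by' * m + my * b)"
  shows "ly = l * m + k * b" "mx = l * m + k * b" "my = m * m + k * c"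
proof -
  \<comment> \<open>\<open>q\<close>, \<open>q'\<close> and \<open>r\<close> are the errors in the
    three claims. In \<open>A\<close>, \<open>B\<close> and \<open>C\<close> everything else
    cancels, leaving homogeneous linear equations for them.\<close>
  obtain q q' r where ly: "ly = l * m + k * b + q" and mx: "mx = l * m + k * b + q'"
      and my: "my = m * m + k * c + r"
    by (metis add.commute diff_add_cancel)
  have "a * (3 * q - q') = 0"
    using A unfolding third k ly mx by (auto simp: algebra_simps)
  then have q': "q' = 3 * q"
    using \<open>a \<noteq> 0\<close> by simp
  have "a * r = b * (4 * q)"
    using B unfolding third k ly mx my q' by (simp add: algebra_simps power2_eq_square)
  moreover have "c * (4 * q) = b * r"
    using C unfolding third k ly mx my q' by (simp add: algebra_simps power2_eq_square)
  ultimately have "4 * q = 0" "r = 0"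
    using linear_system_nondegenerate[OF assms(3)] by blast+
  then show "ly = l * m + k * b" "mx = l * m + k * b" "my = m * m + k * c"
    by (simp_all add: ly mx my q')
qed

text \<open>\<open>A\<close> and \<open>B\<close> equate the mixed derivatives of \<open>l\<close>
  and of \<open>m\<close>. After substitution only the errors \<open>kx - k * l\<close> and
  \<open>ky - k * m\<close> survive, in a nondegenerate homogeneous system.\<close>

lemma second_compatibility:
  fixes a b c :: real
  assumes "a * c - b\<^sup>2 \<noteq> 0"
    and "ay = 2 * (b * l) + a * m" "bx = 2 * (b * l) + a * m"
      "by' = c * l + 2 * (b * m)" "cx = c * l + 2 * (b * m)"
    and "lx = l * l + k * a" "ly = l * m + k * b" "mx = l * m + k * b" "my = m * m + k * c"
    and A: "(lx * m + mx * l) + (kx * b + bx * k) = (ly * l + ly * l) + (ky * a + ay * k)"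
    and B: "(mx * m + mx * m) + (kx * c + cx * k) = (ly * m + my * l) + (ky * b + by' * k)"
  shows "kx = k * l" "ky = k * m"
proof -
  have "a * (ky - k * m) = b * (kx - k * l)" "c * (kx - k * l) = b * (ky - k * m)"
    using A B unfolding assms(2-9) by (simp_all add: algebra_simps)
  from linear_system_nondegenerate[OF assms(1) this]
  show "kx = k * l" "ky = k * m"
    by simp_all
qed

theorem mainTheorem6:
  fixes u :: "real \<Rightarrow> real \<Rightarrow> real" and I J :: "real set"
  assumes "open I" and "is_interval I"
    and "open J" and "is_interval J"
    and "smooth_on (I \<times> J) u"
    and "\<And>x y. x \<in> I \<Longrightarrow> y \<in> J \<Longrightarrow> pdx (pdx u) x y \<noteq> 0"
    and "\<And>x y. x \<in> I \<Longrightarrow> y \<in> J \<Longrightarrow> pdy (pdy u) x y \<noteq> 0"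
    and "\<And>x y. x \<in> I \<Longrightarrow> y \<in> J \<Longrightarrow>
           pdx (pdx u) x y * pdy (pdy u) x y - (pdy (pdx u) x y)\<^sup>2 \<noteq> 0"
    and "\<And>x y. x \<in> I \<Longrightarrow> y \<in> J \<Longrightarrow>
           (pdx (pdx u) x y)\<^sup>2 * pdy (pdy (pdy u)) x y
           - 3 * pdx (pdx u) x y * pdy (pdy u) x y * pdy (pdx (pdx u)) x y
           + 2 * pdy (pdx u) x y * pdy (pdy u) x y * pdx (pdx (pdx u)) x y = 0"
    and "\<And>x y. x \<in> I \<Longrightarrow> y \<in> J \<Longrightarrow>
           (pdy (pdy u) x y)\<^sup>2 * pdx (pdx (pdx u)) x y
           - 3 * pdx (pdx u) x y * pdy (pdy u) x y * pdy (pdy (pdx u)) x y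
           + 2 * pdy (pdx u) x y * pdx (pdx u) x y * pdy (pdy (pdy u)) x y = 0"
  shows "(\<forall>x\<in>I. \<exists>C. is_conic C \<and> (\<lambda>y. (y, u x y)) ` J \<subseteq> C) \<and>
         (\<forall>y\<in>J. \<exists>C. is_conic C \<and> (\<lambda>x. (x, u x y)) ` I \<subseteq> C)"
proof -
  define S where "S = I \<times> J"
  have S: "open S"
    using assms(1,3) by (simp add: S_def open_Times)
  define a where "a = pdx (pdx u)"
  define b where "b = pdy (pdx u)"
  define c where "c = pdy (pdy u)"
  \<comment> \<open>\<open>l\<close> and \<open>m\<close> are forced by the pure third derivatives
    \<open>3 l a\<close> and \<open>3 m c\<close>; \<open>k\<close> is then read off from the
    equation for the \<open>x\<close>-derivative of \<open>l\<close>.\<close>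
  define l where "l x y = pdx a x y / (3 * a x y)" for x y
  define m where "m x y = pdy c x y / (3 * c x y)" for x y
  define k where "k x y = (pdx l x y - l x y * l x y) / a x y" for x y
  have a_nz: "a x y \<noteq> 0" and c_nz: "c x y \<noteq> 0" and det: "a x y * c x y - (b x y)\<^sup>2 \<noteq> 0"
    if "(x, y) \<in> S" for x y
    using that assms(6-8) by (auto simp: S_def a_def b_def c_def)
  have u: "smooth_on S u"
    using assms(5) by (simp add: S_def)
  have a: "smooth_on S a" and b: "smooth_on S b" and c: "smooth_on S c"
    unfolding a_def b_def c_def by (intro smooth_on_pd u)+
  have l: "smooth_on S l" and m: "smooth_on S m"
    unfolding l_def[abs_def] m_def[abs_def]
    by (intro smooth_on_divide smooth_on_mult smooth_on_const smooth_on_pd S a c;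
        simp add: a_nz c_nz)+
  have k: "smooth_on S k"
    unfolding k_def[abs_def]
    by (intro smooth_on_divide smooth_on_diff smooth_on_mult smooth_on_pd S l a a_nz)
  note D = smooth_on_DERIV[OF a] smooth_on_DERIV[OF b] smooth_on_DERIV[OF c]
    smooth_on_DERIV[OF l] smooth_on_DERIV[OF m] smooth_on_DERIV[OF k]
  note commute = smooth_on_pdx_pdy_commute[OF S]

  have ax: "pdx a x y = 3 * (l x y * a x y)" and cy: "pdy c x y = 3 * (m x y * c x y)"
    if "(x, y) \<in> S" for x y
    using a_nz[OF that] c_nz[OF that] by (simp_all add: l_def m_def)
  have ay: "pdy a x y = 2 * (b x y * l x y) + a x y * m x y"
    and b_y: "pdy b x y = c x y * l x y + 2 * (b x y * m x y)" if "(x, y) \<in> S" for x y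
    using third_derivatives_of_system[OF a_nz[OF that] c_nz[OF that] ax[OF that] cy[OF that],
        of "pdy a x y" "b x y" "pdy b x y"] assms(9,10)[of x y] that
    unfolding S_def a_def b_def c_def by auto
  have bx: "pdx b x y = 2 * (b x y * l x y) + a x y * m x y" if "(x, y) \<in> S" for x y
    using commute[OF smooth_on_pd(1)[OF u] that] ay[OF that] by (simp add: a_def b_def)
  have cx: "pdx c x y = c x y * l x y + 2 * (b x y * m x y)" if "(x, y) \<in> S" for x y
  proof -
    \<comment> \<open>Moving the \<open>x\<close>-derivative inwards takes two interchanges; the
      inner one is known only on \<open>S\<close>, hence \<open>pd_cong\<close>.\<close>
    have "pdx c x y = pdy (pdx (pdy u)) x y"
      using commute[OF smooth_on_pd(2)[OF u] that] by (simp add: c_def)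
    also have "\<dots> = pdy b x y"
      unfolding b_def by (rule pd_cong(2)[OF S that commute[OF u]])
    finally show ?thesis
      using b_y[OF that] by simp
  qed

  have lx: "pdx l x y = l x y * l x y + k x y * a x y" if "(x, y) \<in> S" for x y
    using a_nz[OF that] by (simp add: k_def power2_eq_square)
  have *: "pdy l x y = l x y * m x y + k x y * b x y" "pdx m x y = l x y * m x y + k x y * b x y"
    "pdy m x y = m x y * m x y + k x y * c x y" if xy: "(x, y) \<in> S" for x y
  proof -
    note d = D[OF xy]
    \<comment> \<open>Each of \<open>a\<close>, \<open>b\<close>, \<open>c\<close> is differentiated
      in both orders through the closed forms of its first derivatives; comparing the orders gives
      the three compatibility equations.\<close>
    have "pdy (pdx a) x y = 3 * (pdy l x y * a x y + pdy a x y * l x y)"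
      by (rule pd_eqI(2)[OF S xy, of _ "\<lambda>x y. 3 * (l x y * a x y)"];
          intro ax DERIV_add DERIV_mult DERIV_cmult d)
    moreover have "pdx (pdy a) x y = 2 * (pdx b x y * l x y + pdx l x y * b x y)
        + (pdx a x y * m x y + pdx m x y * a x y)"
      by (rule pd_eqI(1)[OF S xy, of _ "\<lambda>x y. 2 * (b x y * l x y) + a x y * m x y"];
          intro ay DERIV_add DERIV_mult DERIV_cmult d)
    moreover have "pdy (pdx b) x y = 2 * (pdy b x y * l x y + pdy l x y * b x y)
        + (pdy a x y * m x y + pdy m x y * a x y)"
      by (rule pd_eqI(2)[OF S xy, of _ "\<lambda>x y. 2 * (b x y * l x y) + a x y * m x y"];
          intro bx DERIV_add DERIV_mult DERIV_cmult d)
    moreover have "pdx (pdy b) x y = (pdx c x y * l x y + pdx l x y * c x y)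
        + 2 * (pdx b x y * m x y + pdx m x y * b x y)"
      by (rule pd_eqI(1)[OF S xy, of _ "\<lambda>x y. c x y * l x y + 2 * (b x y * m x y)"];
          intro b_y DERIV_add DERIV_mult DERIV_cmult d)
    moreover have "pdy (pdx c) x y = (pdy c x y * l x y + pdy l x y * c x y)
        + 2 * (pdy b x y * m x y + pdy m x y * b x y)"
      by (rule pd_eqI(2)[OF S xy, of _ "\<lambda>x y. c x y * l x y + 2 * (b x y * m x y)"];
          intro cx DERIV_add DERIV_mult DERIV_cmult d)
    moreover have "pdx (pdy c) x y = 3 * (pdx m x y * c x y + pdx c x y * m x y)"
      by (rule pd_eqI(1)[OF S xy, of _ "\<lambda>x y. 3 * (m x y * c x y)"];
          intro cy DERIV_add DERIV_mult DERIV_cmult d)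
    ultimately have eqs:
      "2 * (pdx b x y * l x y + pdx l x y * b x y) + (pdx a x y * m x y + pdx m x y * a x y)
        = 3 * (pdy l x y * a x y + pdy a x y * l x y)"
      "(pdx c x y * l x y + pdx l x y * c x y) + 2 * (pdx b x y * m x y + pdx m x y * b x y)
        = 2 * (pdy b x y * l x y + pdy l x y * b x y) + (pdy a x y * m x y + pdy m x y * a x y)"
      "3 * (pdx m x y * c x y + pdx c x y * m x y)
        = (pdy c x y * l x y + pdy l x y * c x y) + 2 * (pdy b x y * m x y + pdy m x y * b x y)"
      using commute[OF a xy] commute[OF b xy] commute[OF c xy] by (simp_all only:)
    show "pdy l x y = l x y * m x y + k x y * b x y" "pdx m x y = l x y * m x y + k x y * b x y"
      "pdy m x y = m x y * m x y + k x y * c x y"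
      by (rule first_compatibility[OF a_nz[OF xy] c_nz[OF xy] det[OF xy] ax[OF xy] ay[OF xy]
            bx[OF xy] b_y[OF xy] cx[OF xy] cy[OF xy] lx[OF xy] eqs])+
  qed
  have kx: "pdx k x y = k x y * l x y" and ky: "pdy k x y = k x y * m x y"
    if xy: "(x, y) \<in> S" for x y
  proof -
    note d = D[OF xy]
    \<comment> \<open>The same comparison one level up, for \<open>l\<close> and \<open>m\<close>,
      whose first derivatives are now closed expressions in \<open>k\<close> and the earlier
      functions.\<close>
    have "pdy (pdx l) x y = (pdy l x y * l x y + pdy l x y * l x y)
        + (pdy k x y * a x y + pdy a x y * k x y)"
      by (rule pd_eqI(2)[OF S xy, of _ "\<lambda>x y. l x y * l x y + k x y * a x y"];
          intro lx DERIV_add DERIV_mult DERIV_cmult d)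
    moreover have "pdx (pdy l) x y = (pdx l x y * m x y + pdx m x y * l x y)
        + (pdx k x y * b x y + pdx b x y * k x y)"
      by (rule pd_eqI(1)[OF S xy, of _ "\<lambda>x y. l x y * m x y + k x y * b x y"];
          intro * DERIV_add DERIV_mult DERIV_cmult d)
    moreover have "pdy (pdx m) x y = (pdy l x y * m x y + pdy m x y * l x y)
        + (pdy k x y * b x y + pdy b x y * k x y)"
      by (rule pd_eqI(2)[OF S xy, of _ "\<lambda>x y. l x y * m x y + k x y * b x y"];
          intro * DERIV_add DERIV_mult DERIV_cmult d)
    moreover have "pdx (pdy m) x y = (pdx m x y * m x y + pdx m x y * m x y)
        + (pdx k x y * c x y + pdx c x y * k x y)"
      by (rule pd_eqI(1)[OF S xy, of _ "\<lambda>x y. m x y * m x y + k x y * c x y"];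
          intro * DERIV_add DERIV_mult DERIV_cmult d)
    ultimately have eqs:
      "(pdx l x y * m x y + pdx m x y * l x y) + (pdx k x y * b x y + pdx b x y * k x y)
        = (pdy l x y * l x y + pdy l x y * l x y) + (pdy k x y * a x y + pdy a x y * k x y)"
      "(pdx m x y * m x y + pdx m x y * m x y) + (pdx k x y * c x y + pdx c x y * k x y)
        = (pdy l x y * m x y + pdy m x y * l x y) + (pdy k x y * b x y + pdy b x y * k x y)"
      using commute[OF l xy] commute[OF m xy] by (simp_all only:)
    show "pdx k x y = k x y * l x y" "pdy k x y = k x y * m x y"
      by (rule second_compatibility[OF det[OF xy] ay[OF xy] bx[OF xy] b_y[OF xy] cx[OF xy]
            lx[OF xy] *[OF xy] eqs])+
  qed

  show ?thesis
  proof (intro conjI ballI)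
    fix x assume "x \<in> I"
    then have S': "(x, y) \<in> S" if "y \<in> J" for y
      using that by (simp add: S_def)
    show "\<exists>C. is_conic C \<and> (\<lambda>y. (y, u x y)) ` J \<subseteq> C"
    \<comment> \<open>On a vertical line \<open>c\<close> and \<open>m\<close> take the roles of
      \<open>a\<close> and \<open>l\<close>, while \<open>k\<close> serves for both
      directions.\<close>
    proof (rule conic_of_ode[where f' = "pdy u x" and a = "c x" and l = "m x" and \<kappa> = "k x"])
      show "convex J"
        using assms(4) by (rule is_interval_convex)
      fix y assume "y \<in> J"
      note xy = S'[OF this]
      show "(u x has_real_derivative pdy u x y) (at y)"
        "(pdy u x has_real_derivative c x y) (at y)"
        "(c x has_real_derivative 3 * (m x y * c x y)) (at y)"
        "(m x has_real_derivative m x y * m x y + k x y * c x y) (at y)"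
        "(k x has_real_derivative k x y * m x y) (at y)"
        "c x y \<noteq> 0"
        using smooth_on_DERIV(2)[OF u xy] smooth_on_DERIV(2)[OF smooth_on_pd(2)[OF u] xy]
          D(6,10,12)[OF xy] cy[OF xy] *(3)[OF xy] ky[OF xy] c_nz[OF xy]
        by (simp_all add: c_def)
    qed
  next
    fix y assume "y \<in> J"
    then have S': "(x, y) \<in> S" if "x \<in> I" for x
      using that by (simp add: S_def)
    show "\<exists>C. is_conic C \<and> (\<lambda>x. (x, u x y)) ` I \<subseteq> C"
    proof (rule conic_of_ode[where f' = "\<lambda>x. pdx u x y" and a = "\<lambda>x. a x y"
          and l = "\<lambda>x. l x y" and \<kappa> = "\<lambda>x. k x y"])
      show "convex I"
        using assms(2) by (rule is_interval_convex)
      fix x assume "x \<in> I"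
      note xy = S'[OF this]
      show "((\<lambda>x. u x y) has_real_derivative pdx u x y) (at x)"
        "((\<lambda>x. pdx u x y) has_real_derivative a x y) (at x)"
        "((\<lambda>x. a x y) has_real_derivative 3 * (l x y * a x y)) (at x)"
        "((\<lambda>x. l x y) has_real_derivative l x y * l x y + k x y * a x y) (at x)"
        "((\<lambda>x. k x y) has_real_derivative k x y * l x y) (at x)"
        "a x y \<noteq> 0"
        using smooth_on_DERIV(1)[OF u xy] smooth_on_DERIV(1)[OF smooth_on_pd(1)[OF u] xy]
          D(1,7,11)[OF xy] ax[OF xy] lx[OF xy] kx[OF xy] a_nz[OF xy]
        by (simp_all add: a_def)
    qed
  qed
qed

end
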